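(* Let $g>0$, $H>0$, $U\in\mathbb R$, $x_L<0<x_R$, $\Omega^-=[x_L,0]$, $\Omega^+=[0,x_R]$. Let $h^{\pm},u^{\pm}$ be sufficiently smooth real-valued solutions on $\Omega^{\pm}\times[0,\infty)$ of $$\frac{\partial h^{\pm}}{\partial t}+\frac{\partial}{\partial x}(Uh^\pm+Hu^\pm)=0,\qquad\frac{\partial u^{\pm}}{\partial t}+\frac{\partial}{\partial x}\left(gh^\pm+Uu^\pm-\frac{H^2U}{3}\frac{\partial^2u^\pm}{\partial x^2}-\frac{H^2}{3}\frac{\partial^2u^\pm}{\partial x\partial t}\right)=0,$$ subject for all $t\ge0$ to the interface conditions at $x=0$ $$[\![h]\!]=0,\quad[\![u]\!]=0,\quad\left[\!\!\left[\frac{\partial u}{\partial x}\right]\!\!\right]=0,\quad\left[\!\!\left[\frac{\partial^2u}{\partial x^2}\right]\!\!\right]=0.$$ Considering only boundary contributions from the interface $x=0$, i.e. assuming that the outer boundary contribution $\operatorname{BT}(h^+,u^+)|_{x=x_R}-\operatorname{BT}(h^-,u^-)|_{x=x_L}$ vanishes for all $t\ge 0$, the total energy is conserved: $$E^-(t)+E^+(t)=E^-(0)+E^+(0)\quad\text{for all }t\ge0.$$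
   Context: The jump is $[\![v]\!]=v^+-v^-$ at $x=0$. The subdomain energies are $E^{\pm}(t)=\frac g2\|h^\pm\|^2_{L^2(\Omega^\pm)}+\frac H2\|u^\pm\|^2_{L^2(\Omega^\pm)}+\frac{H^3}{6}\left\|\frac{\partial u^\pm}{\partial x}\right\|^2_{L^2(\Omega^\pm)}$. The boundary term is $$\operatorname{BT}(h,u)=-gHhu-\frac{gU}{2}h^2-\frac{HU}{2}u^2-\frac{H^3U}{6}\left(\frac{\partial u}{\partial x}\right)^2+\frac{H^3U}{3}u\frac{\partial^2u}{\partial x^2}+\frac{H^3}{3}u\frac{\partial^2u}{\partial x\partial t}.$$ "Sufficiently smooth" means that all partial derivatives appearing exist, are continuous up to the boundary of each subdomain, and mixed partials commute. *)

theory Defs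
  imports "HOL-Analysis.Analysis"
begin

(* Space-time functions are curried: f x t.  They live on S \<times> {0..} with S a
   nondegenerate compact interval; values outside are irrelevant.  Derivatives
   are taken within S and within {0..}, hence are one-sided at the end points
   of S and at t = 0. *)

definition pd_x :: "real set \<Rightarrow> (real \<Rightarrow> real \<Rightarrow> real) \<Rightarrow> real \<Rightarrow> real \<Rightarrow> real" where
  "pd_x S f x t = vector_derivative (\<lambda>y. f y t) (at x within S)"

definition pd_t :: "(real \<Rightarrow> real \<Rightarrow> real) \<Rightarrow> real \<Rightarrow> real \<Rightarrow> real" where
  "pd_t f x t = vector_derivative (\<lambda>s. f x s) (at t within {0..})"

definition cont_on :: "real set \<Rightarrow> (real \<Rightarrow> real \<Rightarrow> real) \<Rightarrow> bool" where
  "cont_on S f \<longleftrightarrow> continuous_on (S \<times> {0..}) (\<lambda>(x, t). f x t)"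

definition has_cont_pd_x :: "real set \<Rightarrow> (real \<Rightarrow> real \<Rightarrow> real) \<Rightarrow> bool" where
  "has_cont_pd_x S f \<longleftrightarrow>
     (\<forall>x\<in>S. \<forall>t\<ge>0. (\<lambda>y. f y t) differentiable (at x within S)) \<and> cont_on S (pd_x S f)"

definition has_cont_pd_t :: "real set \<Rightarrow> (real \<Rightarrow> real \<Rightarrow> real) \<Rightarrow> bool" where
  "has_cont_pd_t S f \<longleftrightarrow>
     (\<forall>x\<in>S. \<forall>t\<ge>0. (\<lambda>s. f x s) differentiable (at t within {0..})) \<and> cont_on S (pd_t f)"

(* The derivatives occurring in the equations, the energy and the boundary term are
   h_t, h_x, u_t, u_x, u_xx, u_xxx, u_xt and u_xxt, the last two in any order. *)
definition sufficiently_smooth ::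
    "real set \<Rightarrow> (real \<Rightarrow> real \<Rightarrow> real) \<Rightarrow> (real \<Rightarrow> real \<Rightarrow> real) \<Rightarrow> bool" where
  "sufficiently_smooth S h u \<longleftrightarrow>
     cont_on S h \<and> has_cont_pd_x S h \<and> has_cont_pd_t S h \<and>
     cont_on S u \<and> has_cont_pd_x S u \<and> has_cont_pd_t S u \<and>
     has_cont_pd_x S (pd_x S u) \<and> has_cont_pd_x S (pd_x S (pd_x S u)) \<and>
     has_cont_pd_x S (pd_t u) \<and> has_cont_pd_t S (pd_x S u) \<and>
     has_cont_pd_x S (pd_x S (pd_t u)) \<and> has_cont_pd_x S (pd_t (pd_x S u)) \<and>
     has_cont_pd_t S (pd_x S (pd_x S u)) \<and>
     (\<forall>x\<in>S. \<forall>t\<ge>0.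
        pd_x S (pd_t u) x t = pd_t (pd_x S u) x t \<and>
        pd_x S (pd_x S (pd_t u)) x t = pd_x S (pd_t (pd_x S u)) x t \<and>
        pd_x S (pd_t (pd_x S u)) x t = pd_t (pd_x S (pd_x S u)) x t)"

definition solves_system ::
    "real \<Rightarrow> real \<Rightarrow> real \<Rightarrow> real set \<Rightarrow> (real \<Rightarrow> real \<Rightarrow> real) \<Rightarrow> (real \<Rightarrow> real \<Rightarrow> real) \<Rightarrow> bool" where
  "solves_system g H U S h u \<longleftrightarrow> (\<forall>x\<in>S. \<forall>t\<ge>0.
     pd_t h x t + pd_x S (\<lambda>y s. U * h y s + H * u y s) x t = 0 \<and>
     pd_t u x t
       + pd_x S (\<lambda>y s. g * h y s + U * u y s
                        - H\<^sup>2 * U / 3 * pd_x S (pd_x S u) y s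
                        - H\<^sup>2 / 3 * pd_x S (pd_t u) y s) x t = 0)"

definition jump :: "(real \<Rightarrow> real \<Rightarrow> real) \<Rightarrow> (real \<Rightarrow> real \<Rightarrow> real) \<Rightarrow> real \<Rightarrow> real" where
  "jump v_minus v_plus t = v_plus 0 t - v_minus 0 t"

definition L2_norm_on :: "real set \<Rightarrow> (real \<Rightarrow> real) \<Rightarrow> real" where
  "L2_norm_on S f = sqrt (LINT x:S|lborel. (f x)\<^sup>2)"

definition energy ::
    "real \<Rightarrow> real \<Rightarrow> real set \<Rightarrow> (real \<Rightarrow> real \<Rightarrow> real) \<Rightarrow> (real \<Rightarrow> real \<Rightarrow> real) \<Rightarrow> real \<Rightarrow> real" where
  "energy g H S h u t =
     g / 2 * (L2_norm_on S (\<lambda>x. h x t))\<^sup>2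
     + H / 2 * (L2_norm_on S (\<lambda>x. u x t))\<^sup>2
     + H ^ 3 / 6 * (L2_norm_on S (\<lambda>x. pd_x S u x t))\<^sup>2"

definition BT ::
    "real \<Rightarrow> real \<Rightarrow> real \<Rightarrow> real set \<Rightarrow> (real \<Rightarrow> real \<Rightarrow> real) \<Rightarrow> (real \<Rightarrow> real \<Rightarrow> real) \<Rightarrow> real \<Rightarrow> real \<Rightarrow> real"
  where
  "BT g H U S h u x t =
     - (g * H * h x t * u x t)
     - g * U / 2 * (h x t)\<^sup>2
     - H * U / 2 * (u x t)\<^sup>2
     - H ^ 3 * U / 6 * (pd_x S u x t)\<^sup>2
     + H ^ 3 * U / 3 * u x t * pd_x S (pd_x S u) x t
     + H ^ 3 / 3 * u x t * pd_x S (pd_t u) x t"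

end

(* Differentiating under the integral sign and inserting the equations for h_t and u_t, the density
   of E'(t) becomes the exact x-derivative of BT, so that E' is the difference of BT at the two end
   points.  At the interface BT contains, besides quantities with zero jump, only u_xt = (u_x)_t,
   whose jump is the time derivative of the jump of u_x and hence vanishes as well. *)

theory Submission
  imports Defs
begin

lemma has_vector_derivative_pd_x:
  assumes "has_cont_pd_x S f" "x \<in> S" "t \<ge> 0"
  shows "((\<lambda>y. f y t) has_vector_derivative pd_x S f x t) (at x within S)"
  using assms unfolding has_cont_pd_x_def pd_x_def vector_derivative_works by blast

lemma has_vector_derivative_pd_t:
  assumes "has_cont_pd_t S f" "x \<in> S" "t \<ge> 0"
  shows "((\<lambda>s. f x s) has_vector_derivative pd_t f x t) (at t within {0..})"
  using assms unfolding has_cont_pd_t_def pd_t_def vector_derivative_works by blast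

text \<open>On a nondegenerate interval a derivative within the interval is unique even at the end
  points, so exhibiting one determines the value chosen by \<open>vector_derivative\<close>.\<close>

lemma pd_x_eqI:
  assumes "a < b" "x \<in> {a..b}"
    and "((\<lambda>y. f y t) has_vector_derivative d) (at x within {a..b})"
  shows "pd_x {a..b} f x t = d"
  unfolding pd_x_def using assms by (intro vector_derivative_within_closed_interval) auto

lemma cont_on_slice:
  assumes "cont_on S f" "t \<ge> 0"
  shows "continuous_on S (\<lambda>x. f x t)"
  using continuous_on_compose2[OF assms(1)[unfolded cont_on_def], of S "\<lambda>x. (x, t)"] assms(2)
  by (simp add: continuous_intros image_subset_iff)

text \<open>The Leibniz rule expects the parameter, here time, as the first coordinate.\<close>

lemma cont_on_swap:
  assumes "cont_on S f"
  shows "continuous_on ({0..} \<times> S) (\<lambda>(t, x). f x t)"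
  using continuous_on_compose2[OF assms[unfolded cont_on_def], of "{0..} \<times> S" "\<lambda>(t, x). (x, t)"]
  by (simp add: case_prod_unfold continuous_intros image_subset_iff)

text \<open>Passes from the Lebesgue integral to the gauge integral, for which the Leibniz rule and
  the fundamental theorem of calculus are applied below. Nonnegativity of the integral lets the
  square cancel the root.\<close>

lemma L2_norm_on_square:
  assumes "continuous_on {a..b} f"
  shows "(L2_norm_on {a..b} f)\<^sup>2 = integral {a..b} (\<lambda>x. (f x)\<^sup>2)"
proof -
  have "set_integrable lborel {a..b} (\<lambda>x. (f x)\<^sup>2)"
    by (intro borel_integrable_atLeastAtMost' continuous_intros assms)
  then have "(LINT x:{a..b}|lborel. (f x)\<^sup>2) = integral {a..b} (\<lambda>x. (f x)\<^sup>2)"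
    by (rule set_borel_integral_eq_integral)
  moreover have "integral {a..b} (\<lambda>x. (f x)\<^sup>2) \<ge> 0"
    by (rule Henstock_Kurzweil_Integration.integral_nonneg)
      (auto intro!: integrable_continuous_interval continuous_intros assms)
  ultimately show ?thesis
    by (simp add: L2_norm_on_def)
qed

lemma has_derivative_L2_norm_square:
  assumes "cont_on {a..b} f" "has_cont_pd_t {a..b} f" "t \<ge> 0"
  shows "((\<lambda>t. (L2_norm_on {a..b} (\<lambda>x. f x t))\<^sup>2) has_vector_derivative
           integral {a..b} (\<lambda>x. 2 * f x t * pd_t f x t)) (at t within {0..})"
proof -
  have "((\<lambda>t. integral (cbox a b) (\<lambda>x. (f x t)\<^sup>2)) has_vector_derivative
           integral (cbox a b) (\<lambda>x. 2 * f x t * pd_t f x t)) (at t within {0..})"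
  proof (rule leibniz_rule_vector_derivative)
    fix s x :: real
    assume "s \<in> {0..}" "x \<in> cbox a b"
    then show "((\<lambda>s. (f x s)\<^sup>2) has_vector_derivative 2 * f x s * pd_t f x s) (at s within {0..})"
      using has_vector_derivative_pd_t[OF assms(2), of x s]
      unfolding has_real_derivative_iff_has_vector_derivative[symmetric]
      by (auto intro!: derivative_eq_intros)
  next
    fix s :: real
    assume "s \<in> {0..}"
    then show "(\<lambda>x. (f x s)\<^sup>2) integrable_on cbox a b"
      using cont_on_slice[OF assms(1), of s]
      by (auto intro!: integrable_continuous_interval continuous_intros)
  next
    have "cont_on {a..b} (pd_t f)"
      using assms(2) by (simp add: has_cont_pd_t_def)
    then show "continuous_on ({0..} \<times> cbox a b) (\<lambda>(s, x). 2 * f x s * pd_t f x s)"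
      using cont_on_swap[OF assms(1)] cont_on_swap[of "{a..b}" "pd_t f"]
      by (auto simp: case_prod_unfold intro!: continuous_intros)
  qed (use assms in auto)
  \<comment> \<open>Norm and integral are identified only at times in \<open>{0..}\<close>, where
    the slices are continuous; this suffices for a derivative within \<open>{0..}\<close>.\<close>
  then show ?thesis
    unfolding cbox_interval
    by (rule has_vector_derivative_transform[rotated 2])
      (use assms in \<open>auto intro!: L2_norm_on_square cont_on_slice\<close>)
qed

lemma has_derivative_energy:
  assumes "a < b" "sufficiently_smooth {a..b} h u" "solves_system g H U {a..b} h u" "t \<ge> 0"
  shows "(energy g H {a..b} h u has_vector_derivative
           BT g H U {a..b} h u b t - BT g H U {a..b} h u a t) (at t within {0..})"
proof -
  let ?S = "{a..b}"
  note smooth = assms(2)[unfolded sufficiently_smooth_def]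
  define ux uxx uxt where "ux = pd_x ?S u" and "uxx = pd_x ?S ux" and "uxt = pd_x ?S (pd_t u)"
  \<comment> \<open>The density of E'(t) before the equations are inserted. Differentiating the
    squares doubles the energy weights g/2, H/2 and H^3/6.\<close>
  define p where "p = (\<lambda>x. g * h x t * pd_t h x t + H * u x t * pd_t u x t
    + H ^ 3 / 3 * ux x t * pd_t ux x t)"
  have int: "(\<lambda>x. 2 * f x t * pd_t f x t) integrable_on ?S"
    if "cont_on ?S f" "has_cont_pd_t ?S f" for f
    using that \<open>t \<ge> 0\<close> cont_on_slice[of ?S f t] cont_on_slice[of ?S "pd_t f" t]
    by (auto simp: has_cont_pd_t_def intro!: integrable_continuous_interval continuous_intros)
  have ints: "(\<lambda>x. 2 * h x t * pd_t h x t) integrable_on ?S"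
      "(\<lambda>x. 2 * u x t * pd_t u x t) integrable_on ?S"
      "(\<lambda>x. 2 * ux x t * pd_t ux x t) integrable_on ?S"
    using smooth by (auto intro!: int simp: ux_def has_cont_pd_x_def)
  \<comment> \<open>Regrouped so that each summand is an energy weight times an integrand delivered
    by \<open>has_derivative_L2_norm_square\<close>.\<close>
  have "p = (\<lambda>x. g / 2 * (2 * h x t * pd_t h x t) + H / 2 * (2 * u x t * pd_t u x t)
      + H ^ 3 / 6 * (2 * ux x t * pd_t ux x t))"
    by (auto simp: p_def algebra_simps)
  then have "integral ?S p = g / 2 * integral ?S (\<lambda>x. 2 * h x t * pd_t h x t)
      + H / 2 * integral ?S (\<lambda>x. 2 * u x t * pd_t u x t)
      + H ^ 3 / 6 * integral ?S (\<lambda>x. 2 * ux x t * pd_t ux x t)"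
    using ints
    by (simp only: Henstock_Kurzweil_Integration.integral_add
        Henstock_Kurzweil_Integration.integral_mult_right integrable_add integrable_on_mult_right)
  moreover have "((\<lambda>t. (L2_norm_on ?S (\<lambda>x. h x t))\<^sup>2) has_vector_derivative
           integral ?S (\<lambda>x. 2 * h x t * pd_t h x t)) (at t within {0..})"
      "((\<lambda>t. (L2_norm_on ?S (\<lambda>x. u x t))\<^sup>2) has_vector_derivative
           integral ?S (\<lambda>x. 2 * u x t * pd_t u x t)) (at t within {0..})"
      "((\<lambda>t. (L2_norm_on ?S (\<lambda>x. ux x t))\<^sup>2) has_vector_derivative
           integral ?S (\<lambda>x. 2 * ux x t * pd_t ux x t)) (at t within {0..})"
    using smooth \<open>t \<ge> 0\<close>
    by (auto intro!: has_derivative_L2_norm_square simp: ux_def has_cont_pd_x_def)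
  ultimately have "(energy g H ?S h u has_vector_derivative integral ?S p) (at t within {0..})"
    unfolding energy_def[abs_def] ux_def[symmetric]
      has_real_derivative_iff_has_vector_derivative[symmetric]
    by (simp only:) (intro DERIV_add DERIV_cmult)
  moreover have "((\<lambda>x. p x) has_integral BT g H U ?S h u b t - BT g H U ?S h u a t) ?S"
  proof (rule fundamental_theorem_of_calculus)
    fix x assume x: "x \<in> ?S"
    note d = has_vector_derivative_pd_x[of ?S _ x t, OF _ x \<open>t \<ge> 0\<close>,
        folded has_real_derivative_iff_has_vector_derivative]
    have hx: "((\<lambda>y. h y t) has_real_derivative pd_x ?S h x t) (at x within ?S)"
      and dux: "((\<lambda>y. u y t) has_real_derivative ux x t) (at x within ?S)"
      and duxx: "((\<lambda>y. ux y t) has_real_derivative uxx x t) (at x within ?S)"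
      and duxxx: "((\<lambda>y. uxx y t) has_real_derivative pd_x ?S uxx x t) (at x within ?S)"
      and duxxt: "((\<lambda>y. uxt y t) has_real_derivative pd_x ?S uxt x t) (at x within ?S)"
      using smooth by (auto simp: ux_def uxx_def uxt_def intro!: d)
    \<comment> \<open>The equations are in conservation form; the flux is expanded by linearity so
      that they can be solved for the time derivatives.\<close>
    have "pd_x ?S (\<lambda>y s. U * h y s + H * u y s) x t = U * pd_x ?S h x t + H * ux x t"
      using hx dux
      by (intro pd_x_eqI[OF \<open>a < b\<close> x])
        (auto simp flip: has_real_derivative_iff_has_vector_derivative intro!: derivative_eq_intros)
    then have ht: "pd_t h x t = - (U * pd_x ?S h x t + H * ux x t)"
      using assms(3) x \<open>t \<ge> 0\<close> by (force simp: solves_system_def)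
    have "pd_x ?S (\<lambda>y s. g * h y s + U * u y s - H\<^sup>2 * U / 3 * uxx y s - H\<^sup>2 / 3 * uxt y s) x t
        = g * pd_x ?S h x t + U * ux x t - H\<^sup>2 * U / 3 * pd_x ?S uxx x t - H\<^sup>2 / 3 * pd_x ?S uxt x t"
      using hx dux duxxx duxxt
      by (intro pd_x_eqI[OF \<open>a < b\<close> x])
        (auto simp flip: has_real_derivative_iff_has_vector_derivative intro!: derivative_eq_intros)
    then have ut: "pd_t u x t = - (g * pd_x ?S h x t + U * ux x t
        - H\<^sup>2 * U / 3 * pd_x ?S uxx x t - H\<^sup>2 / 3 * pd_x ?S uxt x t)"
      using assms(3) x \<open>t \<ge> 0\<close> by (force simp: solves_system_def ux_def uxx_def uxt_def)
    \<comment> \<open>The energy produces (u_x)_t, whereas \<open>BT\<close> and the momentum flux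
      contain (u_t)_x.\<close>
    have uxt: "pd_t ux x t = uxt x t"
      using smooth x \<open>t \<ge> 0\<close> by (simp add: ux_def uxt_def)
    show "((\<lambda>x. BT g H U ?S h u x t) has_vector_derivative p x) (at x within ?S)"
      unfolding BT_def ux_def[symmetric] uxx_def[symmetric] uxt_def[symmetric]
        has_real_derivative_iff_has_vector_derivative[symmetric]
      \<comment> \<open>The products u_x u_xx coming from (u_x)^2 and from u u_xx cancel; what
        remains is \<open>p\<close> with \<open>ht\<close> and \<open>ut\<close> inserted.\<close>
      by (rule hx dux duxx duxxx duxxt derivative_eq_intros refl)+
        (simp add: p_def ht ut uxt power2_eq_square power3_eq_cube algebra_simps)
  qed (use \<open>a < b\<close> in simp)
  ultimately show ?thesis
    by (simp add: integral_unique)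
qed

text \<open>A derivative within \<open>{0..}\<close> sees only nonnegative times, and
  \<open>x\<close> stays fixed. Hence agreement at the interface alone carries over to the time
  derivatives there.\<close>

lemma pd_t_cong:
  assumes "\<And>s. s \<ge> 0 \<Longrightarrow> f x s = f' x s" "t \<ge> 0"
  shows "pd_t f x t = pd_t f' x t"
  unfolding pd_t_def
  by (rule vector_derivative_cong_eq) (use assms in auto)

theorem theorem5:
  fixes g H U x_L x_R :: real
    and h_minus u_minus h_plus u_plus :: "real \<Rightarrow> real \<Rightarrow> real"
    and \<Omega>_minus \<Omega>_plus :: "real set"
  assumes "g > 0" and "H > 0" and "x_L < 0" and "0 < x_R"
    and "\<Omega>_minus = {x_L..0}" and "\<Omega>_plus = {0..x_R}"
    and "sufficiently_smooth \<Omega>_minus h_minus u_minus"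
    and "sufficiently_smooth \<Omega>_plus h_plus u_plus"
    and "solves_system g H U \<Omega>_minus h_minus u_minus"
    and "solves_system g H U \<Omega>_plus h_plus u_plus"
    and "\<And>t. t \<ge> 0 \<Longrightarrow> jump h_minus h_plus t = 0"
    and "\<And>t. t \<ge> 0 \<Longrightarrow> jump u_minus u_plus t = 0"
    and "\<And>t. t \<ge> 0 \<Longrightarrow> jump (pd_x \<Omega>_minus u_minus) (pd_x \<Omega>_plus u_plus) t = 0"
    and "\<And>t. t \<ge> 0 \<Longrightarrow>
      jump (pd_x \<Omega>_minus (pd_x \<Omega>_minus u_minus)) (pd_x \<Omega>_plus (pd_x \<Omega>_plus u_plus)) t = 0"
    and "\<And>t. t \<ge> 0 \<Longrightarrow>
      BT g H U \<Omega>_plus h_plus u_plus x_R t - BT g H U \<Omega>_minus h_minus u_minus x_L t = 0"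
  shows "\<forall>t\<ge>0. energy g H \<Omega>_minus h_minus u_minus t + energy g H \<Omega>_plus h_plus u_plus t
               = energy g H \<Omega>_minus h_minus u_minus 0 + energy g H \<Omega>_plus h_plus u_plus 0"
proof -
  let ?Em = "energy g H \<Omega>_minus h_minus u_minus" and ?Ep = "energy g H \<Omega>_plus h_plus u_plus"
  have interface: "BT g H U \<Omega>_plus h_plus u_plus 0 t = BT g H U \<Omega>_minus h_minus u_minus 0 t"
    if "t \<ge> 0" for t
  proof -
    have "0 \<in> \<Omega>_minus" "0 \<in> \<Omega>_plus"
      using assms(3-6) by auto
    then have "pd_x \<Omega>_minus (pd_t u_minus) 0 t = pd_t (pd_x \<Omega>_minus u_minus) 0 t"
      "pd_x \<Omega>_plus (pd_t u_plus) 0 t = pd_t (pd_x \<Omega>_plus u_plus) 0 t"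
      using assms(7,8) that by (auto simp: sufficiently_smooth_def)
    \<comment> \<open>No jump condition on u_xt is assumed; it follows by differentiating the one
      for u_x along x = 0.\<close>
    moreover have "pd_t (pd_x \<Omega>_plus u_plus) 0 t = pd_t (pd_x \<Omega>_minus u_minus) 0 t"
      using assms(13) that by (intro pd_t_cong) (auto simp: jump_def)
    ultimately show ?thesis
      using assms(11-14)[OF that] by (simp add: BT_def jump_def)
  qed
  have deriv: "((\<lambda>t. ?Em t + ?Ep t) has_vector_derivative 0) (at t within {0..})" if "t \<ge> 0" for t
    using has_vector_derivative_add[OF
        has_derivative_energy[OF assms(3) assms(7)[unfolded assms(5)] assms(9)[unfolded assms(5)] that]
        has_derivative_energy[OF assms(4) assms(8)[unfolded assms(6)] assms(10)[unfolded assms(6)] that]]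
      interface[OF that] assms(15)[OF that]
    by (simp add: assms(5,6))
  \<comment> \<open>A vanishing derivative on the convex set \<open>{0..}\<close> forces a constant;
    comparing its values at t and at 0 gives the claim.\<close>
  have "\<exists>c. \<forall>t\<in>{0..}. ?Em t + ?Ep t = c"
    using deriv
    by (intro has_field_derivative_zero_constant)
      (auto simp: has_real_derivative_iff_has_vector_derivative)
  then show ?thesis
    by auto
qed

end
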